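(* Let $f:\mathcal{S}^{3\times 3}\to \mathbb{R}$ be a quadratic form. Then the following statements are equivalent: (i) $f$ is symmetric polyconvex; (ii) there exist a convex quadratic form $h:\mathcal{S}^{3\times 3}\to \mathbb{R}$ and a matrix $A\in \mathcal{S}^{3\times 3}_+$ such that $f(\varepsilon) = h(\varepsilon)-A:\operatorname{cof} \varepsilon$ for all $\varepsilon\in \mathcal{S}^{3\times 3}$; (iii) there is $A\in \mathcal{S}^{3\times 3}_+$ such that $f(\varepsilon) + A:\operatorname{cof} \varepsilon \geq 0$ for all $\varepsilon\in \mathcal{S}^{3\times 3}$.
   Context: $\mathcal{S}^{3\times 3}$ is the space of symmetric matrices in $\mathbb{R}^{3\times 3}$, $\mathcal{S}^{3\times 3}_+$ the subset of positive semi-definite ones, $F^s=\frac12(F+F^T)$, and $A:B=\sum_{i,j}A_{ij}B_{ij}$. The cofactor matrix is $(\operatorname{cof}F)_{ij}=(-1)^{i+j}\det\widehat F_{ij}$, where $\widehat F_{ij}$ is $F$ with row $i$ and column $j$ deleted. A quadratic form on $\mathcal{S}^{3\times 3}$ is a (homogeneous) quadratic function $f(\varepsilon)=M\varepsilon:\varepsilon$ with a fixed fourth-order tensor $M$. A function $\tilde f:\mathbb{R}^{3\times 3}\to\mathbb{R}$ is polyconvex if there is a convex function $G:\mathbb{R}^{3\times 3}\times\mathbb{R}^{3\times 3}\times\mathbb{R}\to\mathbb{R}$ with $\tilde f(F)=G(F,\operatorname{cof}F,\det F)$ for all $F$. A function $f:\mathcal{S}^{3\times 3}\to\mathbb{R}$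 is symmetric polyconvex if $\tilde f:\mathbb{R}^{3\times 3}\to\mathbb{R}$, $\tilde f(F)=f(F^s)$, is polyconvex. *)

theory Defs
  imports "HOL-Analysis.Analysis"
begin

text \<open>
  Functions on the space of symmetric matrices are rendered as functions on \<^typ>\<open>real^3^3\<close> of which
  only the values on \<open>sym_mats\<close> matter. The contraction \<open>A : B\<close> is the library inner product
  \<open>A \<bullet> B\<close> on \<^typ>\<open>real^3^3\<close>, see \<open>inner_matrix_eq\<close>.
\<close>

definition sym_mats :: "(real^3^3) set" where
  "sym_mats = {A. transpose A = A}"

definition psd_mats :: "(real^3^3) set" where
  "psd_mats = {A \<in> sym_mats. \<forall>x. 0 \<le> x \<bullet> (A *v x)}"

definition sym_part :: "real^3^3 \<Rightarrow> real^3^3" where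
  "sym_part F = (1/2) *\<^sub>R (F + transpose F)"

text \<open>
  In the index type \<^typ>\<open>3\<close> the numeral \<open>3\<close> equals \<open>0\<close>, so neither its order nor its
  representation gives the positions 1, 2, 3; \<open>pos3\<close> does. \<open>skip3 i\<close> lists the two indices different
  from \<open>i\<close> in increasing position.
\<close>

definition pos3 :: "3 \<Rightarrow> nat" where
  "pos3 i = (if i = 1 then 1 else if i = 2 then 2 else 3)"

definition skip3 :: "3 \<Rightarrow> 2 \<Rightarrow> 3" where
  "skip3 i a = (if a = 1 then (if i = 1 then 2 else 1) else (if i = 3 then 2 else 3))"

definition delete_row_col :: "real^3^3 \<Rightarrow> 3 \<Rightarrow> 3 \<Rightarrow> real^2^2" where
  "delete_row_col F i j = (\<chi> a b. F $ skip3 i a $ skip3 j b)"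

definition cof :: "real^3^3 \<Rightarrow> real^3^3" where
  "cof F = (\<chi> i j. (-1) ^ (pos3 i + pos3 j) * det (delete_row_col F i j))"

definition tensor_apply :: "real^3^3^3^3 \<Rightarrow> real^3^3 \<Rightarrow> real^3^3" where
  "tensor_apply M \<epsilon> = (\<chi> i j. \<Sum>k\<in>UNIV. \<Sum>l\<in>UNIV. M $ i $ j $ k $ l * \<epsilon> $ k $ l)"

definition quadratic_form_on_sym :: "(real^3^3 \<Rightarrow> real) \<Rightarrow> bool" where
  "quadratic_form_on_sym f \<longleftrightarrow>
    (\<exists>M. \<forall>\<epsilon>\<in>sym_mats. f \<epsilon> = tensor_apply M \<epsilon> \<bullet> \<epsilon>)"

definition polyconvex :: "(real^3^3 \<Rightarrow> real) \<Rightarrow> bool" where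
  "polyconvex g \<longleftrightarrow>
    (\<exists>G :: (real^3^3) \<times> (real^3^3) \<times> real \<Rightarrow> real.
      convex_on UNIV G \<and> (\<forall>F. g F = G (F, cof F, det F)))"

definition symmetric_polyconvex :: "(real^3^3 \<Rightarrow> real) \<Rightarrow> bool" where
  "symmetric_polyconvex f \<longleftrightarrow> polyconvex (\<lambda>F. f (sym_part F))"

lemma inner_matrix_eq:
  fixes A B :: "real^3^3"
  shows "A \<bullet> B = (\<Sum>i\<in>UNIV. \<Sum>j\<in>UNIV. A $ i $ j * B $ i $ j)"
  by (simp add: inner_vec_def)

lemma sym_part_in_sym_mats: "sym_part F \<in> sym_mats"
  by (simp add: sym_part_def sym_mats_def transpose_def vec_eq_iff add.commute)

lemma matrix_mult_transpose_cof: "F ** transpose (cof F) = det F *\<^sub>R mat 1"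
  by (simp add: vec_eq_iff forall_3 matrix_matrix_mult_def transpose_def mat_def cof_def
      delete_row_col_def skip3_def pos3_def det_2 det_3 sum_3 algebra_simps)

end

theory Submission
  imports Defs
begin

text \<open>
  Split a matrix as \<open>F = \<epsilon> + W\<close> with \<open>\<epsilon>\<close> symmetric and \<open>W\<close> skew, and let \<open>w\<close> be the axial vector of
  \<open>W\<close>, so that \<open>W x = w \<times> x\<close>. Everything rests on the identity \<open>sym_part_cof\<close>:
  the symmetric part of \<open>cof F\<close> is \<open>cof \<epsilon> + w w\<^sup>T\<close>. Hence, for symmetric \<open>A\<close>,
  \<open>A : cof F = A : cof \<epsilon> + w \<bullet> A w\<close>.

  Let \<open>f(F\<^sup>s) = G(F, cof F, det F)\<close> with \<open>G\<close> convex. A subgradient \<open>(B, C, d)\<close> of \<open>G\<close> at the origin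
  gives \<open>B : F + C : cof F + d det F \<le> f(F\<^sup>s)\<close> for all \<open>F\<close>. The terms in \<open>B\<close> and \<open>d\<close> are odd in \<open>F\<close>
  while the other two are even, so averaging over \<open>F\<close> and \<open>- F\<close> leaves \<open>C : cof F \<le> f(F\<^sup>s)\<close>
  (\<open>symmetric_polyconvex_imp_bound\<close>). Averaging once more over \<open>F\<close> and its transpose, and putting
  \<open>A = - C\<^sup>s\<close>, turns this into \<open>0 \<le> f \<epsilon> + A : cof \<epsilon> + w \<bullet> A w\<close> for all \<open>\<epsilon>\<close> and \<open>w\<close>.
  The case \<open>\<epsilon> = 0\<close> says that \<open>A\<close> is positive semi-definite, the case \<open>w = 0\<close> is condition (iii).

  If (iii) holds, \<open>h = f + A : cof\<close> is a nonnegative quadratic form on the symmetric matrices, hence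
  convex; this is (ii). Given (ii), the identity yields
  \<open>f(F\<^sup>s) = h(F\<^sup>s) + w \<bullet> A w - A : cof F\<close>, where the first two terms are convex in \<open>F\<close> because
  \<open>F\<^sup>s\<close> and \<open>w\<close> depend linearly on \<open>F\<close> and \<open>A\<close> is positive semi-definite, and the last is linear in \<open>cof F\<close>; so \<open>f\<close> is symmetric polyconvex.
\<close>

section \<open>Convex functions and quadratic forms\<close>

text \<open>
  The hyperplane that separates the strict epigraph of \<open>G\<close> from the point \<open>(x, G x)\<close> cannot be
  vertical because \<open>G\<close> is finite everywhere; normalising its last coefficient gives the subgradient.
\<close>

lemma convex_on_UNIV_subgradient:
  fixes G :: "'a::euclidean_space \<Rightarrow> real"
  assumes "convex_on UNIV G"
  obtains p where "\<And>y. G x + p \<bullet> (y - x) \<le> G y"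
proof -
  let ?S = "{z. G (fst z) < snd z}" and ?T = "{(x, G x)}"
  have "convex ?S"
  proof (rule convexI)
    fix z z' :: "'a \<times> real" and u v :: real
    assume z: "z \<in> ?S" "z' \<in> ?S" and uv: "0 \<le> u" "0 \<le> v" "u + v = 1"
    have "G (u *\<^sub>R fst z + v *\<^sub>R fst z') \<le> u * G (fst z) + v * G (fst z')"
      using assms uv by (auto simp: convex_on_def)
    also have "\<dots> < u * snd z + v * snd z'"
    proof (cases "u = 0")
      case True
      then show ?thesis using z uv by simp
    next
      case False
      then show ?thesis using z uv
        by (intro add_less_le_mono mult_strict_left_mono mult_left_mono) auto
    qed
    finally show "u *\<^sub>R z + v *\<^sub>R z' \<in> ?S" by simp
  qed
  moreover have "(x, G x + 1) \<in> ?S" by simp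
  then have "?S \<noteq> {}" by blast
  ultimately obtain a b where
    a: "a \<noteq> 0" "\<forall>z\<in>?S. a \<bullet> z \<le> b" and b: "\<forall>z\<in>?T. b \<le> a \<bullet> z"
    using separating_hyperplane_sets[of ?S ?T] by auto
  obtain p q where pq: "a = (p, q)" by (cases a)
  have sep: "p \<bullet> y + q * s \<le> p \<bullet> x + q * G x" if "G y < s" for y s
    using bspec[OF a(2), of "(y, s)"] b that by (simp add: pq)
  \<comment> \<open>A positive \<open>q\<close> is excluded by the epigraph point one unit above \<open>(x, G x)\<close>, and \<open>q = 0\<close> by
    the points above \<open>x + p\<close>.\<close>
  have "q \<le> 0"
    using sep[of x "G x + 1"] by (simp add: algebra_simps)
  moreover have "q \<noteq> 0"
  proof
    assume q: "q = 0"
    then have "p \<bullet> (x + p) \<le> p \<bullet> x"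
      using sep[of "x + p" "G (x + p) + 1"] by simp
    then have "p \<bullet> p = 0"
      by (intro antisym) (simp_all add: inner_add_right)
    then have "p = 0" by simp
    with q a(1) pq show False by (simp add: zero_prod_def)
  qed
  ultimately have q: "q < 0" by simp
  \<comment> \<open>The point \<open>(y, G y)\<close> is missing from the strict epigraph, so it is approached from above.\<close>
  have "G x + (- (p /\<^sub>R q)) \<bullet> (y - x) \<le> G y" for y
  proof (rule dense_ge)
    fix s assume "G y < s"
    from sep[OF this] have "p \<bullet> (y - x) \<le> q * (G x - s)"
      by (simp add: algebra_simps)
    then have "inverse q * (q * (G x - s)) \<le> inverse q * (p \<bullet> (y - x))"
      using q by (intro mult_left_mono_neg) auto
    moreover have "inverse q * (q * (G x - s)) = G x - s"
      using q by simp
    ultimately have "G x - s \<le> inverse q * (p \<bullet> (y - x))"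
      by (simp only:)
    then show "G x + (- (p /\<^sub>R q)) \<bullet> (y - x) \<le> s" by simp
  qed
  then show thesis using that by blast
qed

text \<open>
  For \<open>u + v = 1\<close> the form \<open>Q x = L x \<bullet> x\<close> satisfies
  \<open>u Q x + v Q y - Q (u x + v y) = u v Q (x - y)\<close>. On a subspace, \<open>x - y\<close> is again a
  point at which \<open>Q\<close> is nonnegative.
\<close>

lemma convex_on_nonneg_quadratic:
  fixes L :: "'a::real_inner \<Rightarrow> 'a"
  assumes "linear L" and S: "subspace S" and nonneg: "\<And>x. x \<in> S \<Longrightarrow> 0 \<le> L x \<bullet> x"
  shows "convex_on S (\<lambda>x. L x \<bullet> x)"
  unfolding convex_on_def
proof (intro conjI ballI allI impI)
  show "convex S" using S by (rule subspace_imp_convex)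
  fix x y and u v :: real
  assume xy: "x \<in> S" "y \<in> S" and uv: "0 \<le> u" "0 \<le> v" "u + v = 1"
  interpret linear L by fact
  have u: "u = 1 - v" using uv by simp
  have "u * (L x \<bullet> x) + v * (L y \<bullet> y) - L (u *\<^sub>R x + v *\<^sub>R y) \<bullet> (u *\<^sub>R x + v *\<^sub>R y)
      = u * v * (L (x - y) \<bullet> (x - y))"
    unfolding u by (simp add: add diff scale inner_simps) (simp add: algebra_simps)
  moreover have "0 \<le> u * v * (L (x - y) \<bullet> (x - y))"
    using uv S xy by (intro mult_nonneg_nonneg nonneg subspace_diff) auto
  ultimately show "L (u *\<^sub>R x + v *\<^sub>R y) \<bullet> (u *\<^sub>R x + v *\<^sub>R y) \<le> u * (L x \<bullet> x) + v * (L y \<bullet> y)"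
    by linarith
qed

lemma convex_on_compose_linear:
  assumes "convex_on S f" "linear L" "range L \<subseteq> S"
  shows "convex_on UNIV (\<lambda>x. f (L x))"
proof -
  interpret linear L by fact
  show ?thesis
    using assms(1,3) by (auto simp: convex_on_def add scale image_subset_iff)
qed

section \<open>Symmetric and skew parts of a matrix\<close>

lemma linear_sym_part: "linear sym_part"
  by (rule linearI)
     (simp_all add: sym_part_def transpose_def vec_eq_iff algebra_simps)

lemma sym_part_sym: "\<epsilon> \<in> sym_mats \<Longrightarrow> sym_part \<epsilon> = \<epsilon>"
  by (simp add: sym_mats_def sym_part_def vec_eq_iff)

lemma subspace_sym_mats: "subspace sym_mats"
  by (auto simp: subspace_def sym_mats_def transpose_def vec_eq_iff)

lemma inner_transpose: "(transpose A :: real^3^3) \<bullet> B = A \<bullet> transpose B"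
  by (simp add: inner_matrix_eq transpose_def sum_3)

lemma inner_sym_part: "sym_part A \<bullet> B = A \<bullet> sym_part B"
  by (simp add: sym_part_def inner_simps inner_transpose)

lemma cof_transpose: "cof (transpose F) = transpose (cof F)"
  by (simp add: vec_eq_iff forall_3 transpose_def cof_def
      delete_row_col_def skip3_def pos3_def det_2 algebra_simps)

lemma cof_uminus: "cof (- F) = cof F"
  by (simp add: vec_eq_iff forall_3 cof_def
      delete_row_col_def skip3_def pos3_def det_2 algebra_simps)

text \<open>
  The skew part of \<open>F\<close> is the map \<open>x \<mapsto> axial F \<times> x\<close>.
\<close>

definition axial :: "real^3^3 \<Rightarrow> real^3" where
  "axial F = (1/2) *\<^sub>R vector [F$3$2 - F$2$3, F$1$3 - F$3$1, F$2$1 - F$1$2]"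

definition outer :: "real^3 \<Rightarrow> real^3 \<Rightarrow> real^3^3" where
  "outer v w = (\<chi> i j. v $ i * w $ j)"

lemma axial_sym:
  assumes "\<epsilon> \<in> sym_mats"
  shows "axial \<epsilon> = 0"
proof -
  have swap: "\<epsilon> $ j $ i = \<epsilon> $ i $ j" for i j
  proof -
    have "transpose \<epsilon> $ i $ j = \<epsilon> $ i $ j" using assms by (simp add: sym_mats_def)
    then show ?thesis by (simp only: transpose_def vec_lambda_beta)
  qed
  show ?thesis
    by (simp add: axial_def vec_eq_iff forall_3 swap[of 3 2] swap[of 1 3] swap[of 2 1])
qed

lemma linear_axial: "linear axial"
  by (rule linearI) (simp_all add: axial_def vec_eq_iff forall_3 field_simps)

text \<open>
  The cofactor of a skew matrix with axial vector \<open>w\<close> is \<open>w w\<^sup>T\<close>. The part of \<open>cof (\<epsilon> + W)\<close> that is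
  bilinear in the symmetric \<open>\<epsilon>\<close> and the skew \<open>W\<close> changes sign under transposition, so it is skew and
  drops out.
\<close>

lemma sym_part_cof: "sym_part (cof F) = cof (sym_part F) + outer (axial F) (axial F)"
  by (simp add: vec_eq_iff forall_3 cof_def sym_part_def transpose_def axial_def outer_def
      delete_row_col_def skip3_def pos3_def det_2 field_simps)

lemma inner_outer: "A \<bullet> outer v v = v \<bullet> (A *v v)"
  by (simp add: inner_matrix_eq outer_def inner_vec_def matrix_vector_mult_def sum_distrib_left mult_ac)

lemma ex_skew_axial: "\<exists>W. sym_part W = 0 \<and> axial W = w"
  by (rule exI[of _ "vector [vector [0, - w$3, w$2], vector [w$3, 0, - w$1], vector [- w$2, w$1, 0]]"])
     (simp add: sym_part_def axial_def transpose_def vec_eq_iff forall_3)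

section \<open>The cofactor as a quadratic form\<close>

lemma linear_tensor_apply: "linear (tensor_apply M)"
  by (rule linearI)
     (simp_all add: tensor_apply_def vec_eq_iff sum.distrib sum_distrib_left algebra_simps)

lemma linear_tensor_apply_inner: "linear (\<lambda>M. tensor_apply M F \<bullet> G)"
  by (rule linearI)
     (simp_all add: tensor_apply_def inner_matrix_eq sum.distrib sum_distrib_left sum_distrib_right
       algebra_simps)

definition unit_tensor :: "3 \<Rightarrow> 3 \<Rightarrow> 3 \<Rightarrow> 3 \<Rightarrow> real^3^3^3^3" where
  "unit_tensor a b c d = axis a (axis b (axis c (axis d 1)))"

lemma tensor_apply_unit_tensor:
  "tensor_apply (unit_tensor a b c d) F = F $ c $ d *\<^sub>R axis a (axis b 1)"
proof -
  have "unit_tensor a b c d $ i $ j $ k $ l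
      = (if l = d then if k = c then if i = a \<and> j = b then 1 else 0 else 0 else 0)" for i j k l
    by (simp add: unit_tensor_def axis_def)
  then show ?thesis
    by (simp add: tensor_apply_def vec_eq_iff if_distrib[of "\<lambda>u. u * _"] cong: if_cong)
       (simp add: axis_def)
qed

lemma unit_tensor_form: "tensor_apply (unit_tensor a b c d) F \<bullet> F = F $ a $ b * F $ c $ d"
  by (simp add: tensor_apply_unit_tensor inner_axis')

text \<open>
  Addition in \<^typ>\<open>3\<close> is modulo 3, so \<open>p + 1, p + 2\<close> are the two indices other than \<open>p\<close>
  in cyclic order. Listing them cyclically instead of increasingly absorbs the checkerboard sign.
\<close>

lemma cof_cyclic:
  "cof F $ p $ q
    = F $ (p + 1) $ (q + 1) * F $ (p + 2) $ (q + 2) - F $ (p + 1) $ (q + 2) * F $ (p + 2) $ (q + 1)"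
proof -
  have "(2::3) + 2 = 1" "(3::3) + 1 = 1" "(3::3) + 2 = 2" "(2::3) + 1 = 3" "(1::3) + 2 = 3" "(1::3) + 1 = 2"
    by simp_all
  then show ?thesis
    using exhaust_3[of p] exhaust_3[of q]
    by (elim disjE)
       (simp_all only: cof_def delete_row_col_def skip3_def pos3_def det_2 vec_lambda_beta, simp_all)
qed

text \<open>
  This is what makes \<open>f + A : cof\<close> a quadratic form in the sense of a fixed fourth-order tensor.
\<close>

lemma ex_tensor_inner_cof: "\<exists>M. \<forall>F. tensor_apply M F \<bullet> F = A \<bullet> cof F"
proof -
  define N where "N p q = unit_tensor (p + 1) (q + 1) (p + 2) (q + 2)
      - unit_tensor (p + 1) (q + 2) (p + 2) (q + 1)" for p q
  define M where "M = (\<Sum>p\<in>UNIV. \<Sum>q\<in>UNIV. A $ p $ q *\<^sub>R N p q)"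
  have "tensor_apply M F \<bullet> F = A \<bullet> cof F" for F
  proof -
    interpret T: linear "\<lambda>M. tensor_apply M F \<bullet> F" by (rule linear_tensor_apply_inner)
    show ?thesis
      by (simp add: M_def T.sum T.scale N_def T.diff unit_tensor_form cof_cyclic inner_matrix_eq[of A])
  qed
  then show ?thesis by blast
qed

section \<open>The equivalence\<close>

text \<open>
  The subgradient of \<open>G\<close> is taken at the origin, where \<open>G\<close> vanishes. Of the subgradient inequality
  only the part even in \<open>F\<close> survives averaging over \<open>F\<close> and \<open>- F\<close>.
\<close>

lemma symmetric_polyconvex_imp_bound:
  assumes f: "quadratic_form_on_sym f" and "symmetric_polyconvex f"
  shows "\<exists>C. \<forall>F. C \<bullet> cof F \<le> f (sym_part F)"
proof -
  interpret S: linear sym_part by (rule linear_sym_part)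
  obtain M where M: "\<And>\<epsilon>. \<epsilon> \<in> sym_mats \<Longrightarrow> f \<epsilon> = tensor_apply M \<epsilon> \<bullet> \<epsilon>"
    using f by (auto simp: quadratic_form_on_sym_def)
  interpret T: linear "tensor_apply M" by (rule linear_tensor_apply)
  obtain G :: "(real^3^3) \<times> (real^3^3) \<times> real \<Rightarrow> real"
    where G: "convex_on UNIV G" "\<And>F. f (sym_part F) = G (F, cof F, det F)"
    using assms(2) by (auto simp: symmetric_polyconvex_def polyconvex_def)
  obtain p where p: "\<And>y. G 0 + p \<bullet> (y - 0) \<le> G y"
    using convex_on_UNIV_subgradient[OF G(1), of 0] by blast
  obtain B C d where BCd: "p = (B, C, d)" by (cases p)
  have det_uminus: "det (- F) = - det F" for F :: "real^3^3"
    by (simp add: det_3)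
  have "cof 0 = 0"
    by (simp add: vec_eq_iff cof_def delete_row_col_def det_2)
  then have "G 0 = f (sym_part 0)"
    using G(2)[of 0] det_0[where 'n=3 and 'a=real] by (simp add: zero_prod_def mat_0)
  also have "\<dots> = 0"
    using M[OF sym_part_in_sym_mats[of 0]] by (simp add: S.zero)
  finally have "G 0 = 0" .
  then have bound: "B \<bullet> F + C \<bullet> cof F + d * det F \<le> f (sym_part F)" for F
    using p[of "(F, cof F, det F)"] by (simp add: BCd G(2))
  have even: "f (sym_part (- F)) = f (sym_part F)" for F
    by (simp only: M[OF sym_part_in_sym_mats]) (simp add: S.neg T.neg)
  have "C \<bullet> cof F \<le> f (sym_part F)" for F
    using bound[of F] bound[of "- F"] by (simp add: even cof_uminus det_uminus)
  then show ?thesis by blast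
qed

text \<open>
  Transposing \<open>F\<close> does not affect \<open>f(F\<^sup>s)\<close>, so in the previous bound \<open>cof F\<close> may be replaced by its
  symmetric part, which splits into \<open>cof (F\<^sup>s)\<close> and the contribution of the axial vector. Since the
  symmetric part and the axial vector can be prescribed independently, setting either to \<open>0\<close>
  isolates one of the two claims on \<open>A\<close>.
\<close>

lemma symmetric_polyconvex_imp_nonneg:
  assumes f: "quadratic_form_on_sym f" and "symmetric_polyconvex f"
  shows "\<exists>A\<in>psd_mats. \<forall>\<epsilon>\<in>sym_mats. 0 \<le> f \<epsilon> + A \<bullet> cof \<epsilon>"
proof -
  obtain C where C: "\<And>F. C \<bullet> cof F \<le> f (sym_part F)"
    using symmetric_polyconvex_imp_bound[OF assms] by blast
  have sym_transpose: "sym_part (transpose F) = sym_part F" for F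
    by (simp add: sym_part_def add.commute)
  define A where "A = - sym_part C"
  have A: "A \<in> sym_mats"
    by (simp add: A_def subspace_neg subspace_sym_mats sym_part_in_sym_mats)
  have bound: "0 \<le> f (sym_part F) + A \<bullet> cof (sym_part F) + axial F \<bullet> (A *v axial F)" for F
  proof -
    have "C \<bullet> sym_part (cof F) \<le> f (sym_part F)"
      using C[of F] C[of "transpose F"]
      by (simp add: sym_transpose cof_transpose) (simp add: sym_part_def inner_simps)
    moreover have "C \<bullet> sym_part (cof F) = sym_part C \<bullet> sym_part (cof F)"
      by (simp add: inner_sym_part sym_part_sym sym_part_in_sym_mats)
    ultimately show ?thesis
      by (simp add: A_def sym_part_cof inner_simps flip: inner_outer)
  qed
  have "0 \<le> w \<bullet> (A *v w)" for w
  proof -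
    obtain W where W: "sym_part W = 0" "axial W = w" using ex_skew_axial by blast
    have "f 0 = 0" "cof 0 = 0"
      using f subspace_0[OF subspace_sym_mats]
      by (auto simp: quadratic_form_on_sym_def vec_eq_iff cof_def delete_row_col_def det_2)
    then show ?thesis using bound[of W] W by simp
  qed
  with A have "A \<in> psd_mats" by (simp add: psd_mats_def)
  moreover have "0 \<le> f \<epsilon> + A \<bullet> cof \<epsilon>" if "\<epsilon> \<in> sym_mats" for \<epsilon>
  proof -
    have "axial \<epsilon> = 0"
      using that by (rule axial_sym)
    then show ?thesis using bound[of \<epsilon>] that by (simp add: sym_part_sym)
  qed
  ultimately show ?thesis by blast
qed

lemma nonneg_imp_convex_decomposition:
  assumes f: "quadratic_form_on_sym f"
    and nonneg: "\<And>\<epsilon>. \<epsilon> \<in> sym_mats \<Longrightarrow> 0 \<le> f \<epsilon> + A \<bullet> cof \<epsilon>"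
  shows "\<exists>h. quadratic_form_on_sym h \<and> convex_on sym_mats h \<and>
    (\<forall>\<epsilon>\<in>sym_mats. f \<epsilon> = h \<epsilon> - A \<bullet> cof \<epsilon>)"
proof -
  obtain M where M: "\<And>\<epsilon>. \<epsilon> \<in> sym_mats \<Longrightarrow> f \<epsilon> = tensor_apply M \<epsilon> \<bullet> \<epsilon>"
    using f by (auto simp: quadratic_form_on_sym_def)
  obtain N where N: "\<And>F. tensor_apply N F \<bullet> F = A \<bullet> cof F"
    using ex_tensor_inner_cof by blast
  define h where "h \<epsilon> = tensor_apply (M + N) \<epsilon> \<bullet> \<epsilon>" for \<epsilon>
  have h: "h \<epsilon> = f \<epsilon> + A \<bullet> cof \<epsilon>" if "\<epsilon> \<in> sym_mats" for \<epsilon>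
    using M[OF that] linear_add[OF linear_tensor_apply_inner, of M N \<epsilon> \<epsilon>] by (simp add: h_def N)
  have "convex_on sym_mats h"
    unfolding h_def using nonneg h
    by (intro convex_on_nonneg_quadratic linear_tensor_apply subspace_sym_mats) (simp add: h_def)
  moreover have "quadratic_form_on_sym h"
    by (auto simp: quadratic_form_on_sym_def h_def)
  ultimately show ?thesis using h by auto
qed

text \<open>
  Writing \<open>A : cof (F\<^sup>s) = A : cof F - w \<bullet> A w\<close> with \<open>w = axial F\<close> trades the nonlinear term for one
  linear in \<open>cof F\<close>, at the price of \<open>w \<bullet> A w\<close>; this is convex in \<open>F\<close> exactly because \<open>A\<close> is
  positive semi-definite.
\<close>

lemma convex_decomposition_imp_symmetric_polyconvex:
  assumes A: "A \<in> psd_mats" and h: "convex_on sym_mats h"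
    and f: "\<And>\<epsilon>. \<epsilon> \<in> sym_mats \<Longrightarrow> f \<epsilon> = h \<epsilon> - A \<bullet> cof \<epsilon>"
  shows "symmetric_polyconvex f"
proof -
  define G :: "(real^3^3) \<times> (real^3^3) \<times> real \<Rightarrow> real" where
    "G x = h (sym_part (fst x)) + (A *v axial (fst x)) \<bullet> axial (fst x) + (- A) \<bullet> fst (snd x)" for x
  have lin: "linear (\<lambda>x. sym_part (fst x))" "linear (\<lambda>x. axial (fst x))"
    using linear_compose[OF linear_fst linear_sym_part] linear_compose[OF linear_fst linear_axial]
    by (simp_all add: o_def)
  have "convex_on UNIV (\<lambda>v. (A *v v) \<bullet> v)"
    using A by (intro convex_on_nonneg_quadratic) (auto simp: psd_mats_def inner_commute)
  from convex_on_compose_linear[OF this lin(2)]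
  have "convex_on UNIV (\<lambda>x :: (real^3^3) \<times> (real^3^3) \<times> real. (A *v axial (fst x)) \<bullet> axial (fst x))"
    by simp
  moreover have "convex_on UNIV (\<lambda>x :: (real^3^3) \<times> (real^3^3) \<times> real. h (sym_part (fst x)))"
    by (rule convex_on_compose_linear[OF h lin(1)]) (auto simp: sym_part_in_sym_mats)
  moreover have "convex_on UNIV (\<lambda>x :: (real^3^3) \<times> (real^3^3) \<times> real. (- A) \<bullet> fst (snd x))"
    by (auto simp: convex_on_def inner_simps)
  ultimately have "convex_on UNIV G"
    unfolding G_def by (intro convex_on_add)
  moreover have "f (sym_part F) = G (F, cof F, det F)" for F
  proof -
    have "A \<bullet> cof F = A \<bullet> sym_part (cof F)"
      using A by (simp add: psd_mats_def sym_part_sym flip: inner_sym_part)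
    then show ?thesis
      by (simp add: G_def f sym_part_in_sym_mats sym_part_cof inner_add_right inner_outer inner_commute)
  qed
  ultimately show ?thesis
    by (auto simp: symmetric_polyconvex_def polyconvex_def)
qed

theorem proposition5p6:
  fixes f :: "real^3^3 \<Rightarrow> real"
  assumes "quadratic_form_on_sym f"
  shows "(symmetric_polyconvex f \<longleftrightarrow>
           (\<exists>h :: real^3^3 \<Rightarrow> real. \<exists>A\<in>psd_mats.
              quadratic_form_on_sym h \<and> convex_on sym_mats h \<and>
              (\<forall>\<epsilon>\<in>sym_mats. f \<epsilon> = h \<epsilon> - A \<bullet> cof \<epsilon>)))
       \<and> (symmetric_polyconvex f \<longleftrightarrow>
           (\<exists>A\<in>psd_mats. \<forall>\<epsilon>\<in>sym_mats. f \<epsilon> + A \<bullet> cof \<epsilon> \<ge> 0))"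
proof -
  let ?poly = "symmetric_polyconvex f"
  let ?split = "\<exists>h :: real^3^3 \<Rightarrow> real. \<exists>A\<in>psd_mats.
      quadratic_form_on_sym h \<and> convex_on sym_mats h \<and>
      (\<forall>\<epsilon>\<in>sym_mats. f \<epsilon> = h \<epsilon> - A \<bullet> cof \<epsilon>)"
  let ?nonneg = "\<exists>A\<in>psd_mats. \<forall>\<epsilon>\<in>sym_mats. f \<epsilon> + A \<bullet> cof \<epsilon> \<ge> 0"
  have "?nonneg" if "?poly"
    using symmetric_polyconvex_imp_nonneg[OF assms that] .
  moreover have "?split" if "?nonneg"
  proof -
    from that obtain A where A: "A \<in> psd_mats"
      and "\<And>\<epsilon>. \<epsilon> \<in> sym_mats \<Longrightarrow> 0 \<le> f \<epsilon> + A \<bullet> cof \<epsilon>" by blast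
    from nonneg_imp_convex_decomposition[OF assms this(2)] A show ?thesis by blast
  qed
  moreover have "?poly" if "?split"
  proof -
    from that obtain h A where "A \<in> psd_mats" "convex_on sym_mats h"
      and "\<And>\<epsilon>. \<epsilon> \<in> sym_mats \<Longrightarrow> f \<epsilon> = h \<epsilon> - A \<bullet> cof \<epsilon>" by blast
    then show ?thesis by (rule convex_decomposition_imp_symmetric_polyconvex)
  qed
  ultimately show ?thesis by argo
qed

end
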